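(* Fix the parameters $\mu\in\mathbb{R}$ and $\sigma>0$, and let $\rho^{(t)}$, $\rho_u$, $f^{(t)}_\alpha$ and $\langle\mathrm{IGN}\rangle(\alpha)$ be as defined in the context. Put $r_t=\rho^{(t)}(s_t)/\rho_u(s_t)$ for $t=1,\dots,T$. Then there is improvement from including the unconditional density in the sense of the logarithmic scoring rule, i.e. there exists $\alpha_*\in(0,1)$ with $$\langle\mathrm{IGN}\rangle(\alpha_* )<\min\{\langle\mathrm{IGN}\rangle(0),\ \langle\mathrm{IGN}\rangle(1)\},$$ if and only if $$\frac1T\sum_{t=1}^T r_t>1\quad\text{and}\quad \frac1T\sum_{t=1}^T\frac1{r_t}>1 .$$
   Context: Let $T,N\ge1$ be integers, let $s_1,\dots,s_T\in\mathbb{R}$ be observations and, for each $t$, let $X_1^{(t)},\dots,X_N^{(t)}\in\mathbb{R}$ be an ensemble of point forecasts of $s_t$. Let $K(\xi)=\frac{1}{\sqrt{2\pi}}e^{-\xi^2/2}$. - Conditional density forecast (offset $\mu$, kernel width $\sigma>0$): $\rho^{(t)}(x)=\frac{1}{\sigma N}\sum_{i=1}^N K\{(x-X_i^{(t)}-\mu)/\sigma\}$. - Unconditional density: $\rho_u(x)=\frac{1}{\sigma_u T}\sum_{t=1}^T K\{(x-s_t-\mu_u)/\sigma_u\}$, with fixed $\sigma_u>0$ and $\mu_u\in\mathbb{R}$. - Mixture density with mixture parameter $\alpha\in[0,1]$: $f_\alpha^{(t)}(x)=\alpha\rho^{(t)}(x)+(1-\alpha)\rho_u(x)$. - Logarithmic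 score (average Ignorance; lower is better): $\langle\mathrm{IGN}\rangle(\alpha)=-\frac1T\sum_{t=1}^T\log f_\alpha^{(t)}(s_t)$. The case $\alpha=1$ is the conditional forecast alone and $\alpha=0$ is the unconditional density alone. *)

theory Defs
  imports "HOL-Probability.Probability"
begin

(* Forecast times are t = 1, ..., T and ensemble members i = 1, ..., N; X t i is the i-th
   member of the ensemble for the observation s t. Values outside these ranges are irrelevant.
   The Gaussian kernel K is std_normal_density. *)

definition cond_density ::
  "nat \<Rightarrow> (nat \<Rightarrow> nat \<Rightarrow> real) \<Rightarrow> real \<Rightarrow> real \<Rightarrow> nat \<Rightarrow> real \<Rightarrow> real" where
  "cond_density N X \<mu> \<sigma> t x =
     1 / (\<sigma> * real N) * (\<Sum>i = 1..N. std_normal_density ((x - X t i - \<mu>) / \<sigma>))"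

definition uncond_density ::
  "nat \<Rightarrow> (nat \<Rightarrow> real) \<Rightarrow> real \<Rightarrow> real \<Rightarrow> real \<Rightarrow> real" where
  "uncond_density T s \<mu>\<^sub>u \<sigma>\<^sub>u x =
     1 / (\<sigma>\<^sub>u * real T) * (\<Sum>t = 1..T. std_normal_density ((x - s t - \<mu>\<^sub>u) / \<sigma>\<^sub>u))"

definition mixture_density ::
  "(nat \<Rightarrow> real \<Rightarrow> real) \<Rightarrow> (real \<Rightarrow> real) \<Rightarrow> real \<Rightarrow> nat \<Rightarrow> real \<Rightarrow> real" where
  "mixture_density \<rho> \<rho>\<^sub>u \<alpha> t x = \<alpha> * \<rho> t x + (1 - \<alpha>) * \<rho>\<^sub>u x"

definition mean_ignorance ::
  "nat \<Rightarrow> (nat \<Rightarrow> real) \<Rightarrow> (nat \<Rightarrow> real \<Rightarrow> real) \<Rightarrow> real" where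
  "mean_ignorance T s f = - (1 / real T * (\<Sum>t = 1..T. ln (f t (s t))))"

end

theory Submission
  imports Defs
begin

text \<open>
  Let \<open>G \<alpha>\<close> be the sum of the logarithms of the mixture densities \<open>\<alpha> a + (1 - \<alpha>) b\<close> at the observations.
  The slope of \<open>G\<close> at \<open>0\<close> is \<open>\<Sum>(a / b - 1)\<close>. If it is positive, \<open>G\<close> exceeds \<open>G 0\<close> at all small
  \<open>\<alpha> > 0\<close>; conversely \<open>ln x \<le> x - 1\<close> bounds \<open>G \<alpha> - G 0\<close> by \<open>\<alpha>\<close> times this slope. Exchanging \<open>a\<close> and \<open>b\<close>
  gives the same at \<open>\<alpha> = 1\<close>. When both conditions hold, a mixture close enough to the better of
  the two endpoints beats both.
\<close>

text \<open>Each logarithm is concave in \<alpha>, so its tangent at 0 bounds it on the whole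
  interval, and a gain at any single \<alpha> forces a positive slope. For infinite \<open>S\<close>
  all sums and \<open>card S\<close> are 0, so \<open>gain\<close> is false.\<close>

lemma ratio_sum_gt_card_if_mixture_gain:
  fixes a b :: "'a \<Rightarrow> real"
  assumes a: "\<And>t. t \<in> S \<Longrightarrow> a t > 0" and b: "\<And>t. t \<in> S \<Longrightarrow> b t > 0"
    and \<alpha>: "0 < \<alpha>" "\<alpha> < 1"
    and gain: "(\<Sum>t\<in>S. ln (b t)) < (\<Sum>t\<in>S. ln (\<alpha> * a t + (1 - \<alpha>) * b t))"
  shows "(\<Sum>t\<in>S. a t / b t) > real (card S)"
proof -
  have "ln (\<alpha> * a t + (1 - \<alpha>) * b t) - ln (b t) \<le> \<alpha> * (a t / b t - 1)" if "t \<in> S" for t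
  proof -
    have pos: "\<alpha> * a t + (1 - \<alpha>) * b t > 0"
      using a[OF that] b[OF that] \<alpha> by (simp add: add_pos_pos)
    then have "ln (\<alpha> * a t + (1 - \<alpha>) * b t) - ln (b t) = ln ((\<alpha> * a t + (1 - \<alpha>) * b t) / b t)"
      using b[OF that] by (simp add: ln_div)
    also have "\<dots> \<le> (\<alpha> * a t + (1 - \<alpha>) * b t) / b t - 1"
      using pos b[OF that] by (intro ln_le_minus_one) simp
    also have "\<dots> = \<alpha> * (a t / b t - 1)"
      using b[OF that] by (simp add: field_simps)
    finally show ?thesis .
  qed
  then have "(\<Sum>t\<in>S. ln (\<alpha> * a t + (1 - \<alpha>) * b t) - ln (b t)) \<le> (\<Sum>t\<in>S. \<alpha> * (a t / b t - 1))"
    by (rule sum_mono)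
  also have "\<dots> = \<alpha> * ((\<Sum>t\<in>S. a t / b t) - real (card S))"
    by (simp add: sum_distrib_left[symmetric] sum_subtractf)
  finally have "0 < \<alpha> * ((\<Sum>t\<in>S. a t / b t) - real (card S))"
    using gain by (simp add: sum_subtractf)
  then show ?thesis
    using \<alpha> by (simp add: zero_less_mult_iff)
qed

lemma mixture_gain_if_ratio_sum_gt_card:
  fixes a b :: "'a \<Rightarrow> real"
  assumes b: "\<And>t. t \<in> S \<Longrightarrow> b t > 0"
    and gt: "(\<Sum>t\<in>S. a t / b t) > real (card S)"
  obtains \<alpha> where "0 < \<alpha>" "\<alpha> < 1"
    "(\<Sum>t\<in>S. ln (b t)) < (\<Sum>t\<in>S. ln (\<alpha> * a t + (1 - \<alpha>) * b t))"
proof -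
  let ?G = "\<lambda>\<alpha>. \<Sum>t\<in>S. ln (\<alpha> * a t + (1 - \<alpha>) * b t)"
  \<comment> \<open>At 0 the argument of each \<open>ln\<close> is \<open>b t\<close>, so positivity
    of \<open>b\<close> makes every summand differentiable there.\<close>
  have "(?G has_real_derivative (\<Sum>t\<in>S. (a t - b t) / b t)) (at 0)"
    using b by (auto intro!: derivative_eq_intros sum.cong simp: field_simps)
  moreover have "(\<Sum>t\<in>S. (a t - b t) / b t) = (\<Sum>t\<in>S. a t / b t - 1)"
    using b by (intro sum.cong) (force simp: diff_divide_distrib)+
  then have "(\<Sum>t\<in>S. (a t - b t) / b t) > 0"
    using gt by (simp add: sum_subtractf)
  ultimately obtain d where d: "d > 0" "\<And>h. 0 < h \<Longrightarrow> h < d \<Longrightarrow> ?G 0 < ?G (0 + h)"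
    using DERIV_pos_inc_right[of ?G _ 0] by blast
  \<comment> \<open>Halving \<open>d\<close> stays strictly inside the range of increase; the cap
    1/2 keeps the weight below 1 when \<open>d\<close> is large.\<close>
  have "?G 0 < ?G (0 + min (d / 2) (1 / 2))"
    using d(1) by (intro d(2)) auto
  then show thesis
    using d(1) by (intro that[of "min (d / 2) (1 / 2)"]) auto
qed

lemma cond_density_pos:
  assumes "N \<ge> 1" "\<sigma> > 0"
  shows "cond_density N X \<mu> \<sigma> t x > 0"
  unfolding cond_density_def using assms
  by (intro mult_pos_pos sum_pos divide_pos_pos normal_density_pos) auto

lemma uncond_density_pos:
  assumes "T \<ge> 1" "\<sigma>\<^sub>u > 0"
  shows "uncond_density T s \<mu>\<^sub>u \<sigma>\<^sub>u x > 0"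
  unfolding uncond_density_def using assms
  by (intro mult_pos_pos sum_pos divide_pos_pos normal_density_pos) auto

theorem proposition2:
  fixes T N :: nat
    and s :: "nat \<Rightarrow> real"
    and X :: "nat \<Rightarrow> nat \<Rightarrow> real"
    and \<mu> \<sigma> \<mu>\<^sub>u \<sigma>\<^sub>u :: real
    and \<rho> :: "nat \<Rightarrow> real \<Rightarrow> real"
    and \<rho>\<^sub>u :: "real \<Rightarrow> real"
    and IGN :: "real \<Rightarrow> real"
    and r :: "nat \<Rightarrow> real"
  assumes "T \<ge> 1" and "N \<ge> 1" and "\<sigma> > 0" and "\<sigma>\<^sub>u > 0"
  defines "\<rho> \<equiv> cond_density N X \<mu> \<sigma>"
    and "\<rho>\<^sub>u \<equiv> uncond_density T s \<mu>\<^sub>u \<sigma>\<^sub>u"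
    and "IGN \<equiv> (\<lambda>\<alpha>. mean_ignorance T s (mixture_density \<rho> \<rho>\<^sub>u \<alpha>))"
    and "r \<equiv> (\<lambda>t. \<rho> t (s t) / \<rho>\<^sub>u (s t))"
  shows "(\<exists>\<alpha>. 0 < \<alpha> \<and> \<alpha> < 1 \<and> IGN \<alpha> < min (IGN 0) (IGN 1))
     \<longleftrightarrow> (1 / real T * (\<Sum>t = 1..T. r t) > 1 \<and> 1 / real T * (\<Sum>t = 1..T. 1 / r t) > 1)"
proof -
  define a where "a = (\<lambda>t. \<rho> t (s t))"
  define b where "b = (\<lambda>t. \<rho>\<^sub>u (s t))"
  define G where "G = (\<lambda>\<alpha>. \<Sum>t = 1..T. ln (\<alpha> * a t + (1 - \<alpha>) * b t))"
  have a: "a t > 0" and b: "b t > 0" for t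
    using assms(1-4) by (simp_all add: a_def b_def \<rho>_def \<rho>\<^sub>u_def cond_density_pos uncond_density_pos)
  have G0: "G 0 = (\<Sum>t = 1..T. ln (b t))" and G1: "G 1 = (\<Sum>t = 1..T. ln (a t))"
    by (simp_all add: G_def)
  \<comment> \<open>Reflecting the weight exchanges \<open>a\<close> and \<open>b\<close>, which
    carries both lemmas from the endpoint 0 to the endpoint 1.\<close>
  have G_swap: "G (1 - \<alpha>) = (\<Sum>t = 1..T. ln (\<alpha> * b t + (1 - \<alpha>) * a t))" for \<alpha>
    by (simp add: G_def add.commute)
  have "IGN \<alpha> = - (G \<alpha> / real T)" for \<alpha>
    by (simp add: IGN_def mean_ignorance_def mixture_density_def G_def a_def b_def)
  \<comment> \<open>The factor -1/T reverses the order, so lower ignorance means larger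
    \<open>G\<close>.\<close>
  then have IGN_less: "IGN \<alpha> < min (IGN 0) (IGN 1) \<longleftrightarrow> G 0 < G \<alpha> \<and> G 1 < G \<alpha>" for \<alpha>
    using \<open>T \<ge> 1\<close> by (simp add: divide_less_cancel)
  have mean_gt: "1 / real T * x > 1 \<longleftrightarrow> x > real T" for x
    using \<open>T \<ge> 1\<close> by (simp add: less_divide_eq)
  have r: "r t = a t / b t" for t
    by (simp add: r_def a_def b_def)
  have "(\<exists>\<alpha>. 0 < \<alpha> \<and> \<alpha> < 1 \<and> G 0 < G \<alpha> \<and> G 1 < G \<alpha>)
    \<longleftrightarrow> (\<Sum>t = 1..T. a t / b t) > real T \<and> (\<Sum>t = 1..T. b t / a t) > real T"
  proof safe
    fix \<alpha> assume \<alpha>: "0 < \<alpha>" "\<alpha> < 1" "G 0 < G \<alpha>" "G 1 < G \<alpha>"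
    show "(\<Sum>t = 1..T. a t / b t) > real T"
      using ratio_sum_gt_card_if_mixture_gain[of "{1..T}" a b \<alpha>] a b \<alpha> G0 by (simp add: G_def)
    show "(\<Sum>t = 1..T. b t / a t) > real T"
      using ratio_sum_gt_card_if_mixture_gain[of "{1..T}" b a "1 - \<alpha>"] a b \<alpha> G1 G_swap[of "1 - \<alpha>"]
      by simp
  next
    assume gt: "(\<Sum>t = 1..T. a t / b t) > real T" "(\<Sum>t = 1..T. b t / a t) > real T"
    \<comment> \<open>In this lemma \<open>b\<close> is the first function argument: the instance
      \<open>b a\<close> concerns the ratios \<open>a t / b t\<close>, and \<open>a b\<close> below
      concerns their reciprocals.\<close>
    obtain \<alpha> where \<alpha>: "0 < \<alpha>" "\<alpha> < 1" "G 0 < G \<alpha>"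
      using mixture_gain_if_ratio_sum_gt_card[of "{1..T}" b a] b gt(1)
      unfolding G0 G_def by auto
    obtain \<beta> where \<beta>: "0 < \<beta>" "\<beta> < 1" "G 1 < G (1 - \<beta>)"
      using mixture_gain_if_ratio_sum_gt_card[of "{1..T}" a b] a gt(2)
      unfolding G1 G_swap by auto
    show "\<exists>\<alpha>. 0 < \<alpha> \<and> \<alpha> < 1 \<and> G 0 < G \<alpha> \<and> G 1 < G \<alpha>"
    \<comment> \<open>Each witness is only known to beat its own endpoint; the one belonging to the
      larger endpoint value then beats the other endpoint as well.\<close>
    proof (cases "G 1 \<le> G 0")
      case True
      then show ?thesis using \<alpha> by (intro exI[of _ \<alpha>]) auto
    next
      case False
      then show ?thesis using \<beta> by (intro exI[of _ "1 - \<beta>"]) auto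
    qed
  qed
  then show ?thesis
    unfolding IGN_less mean_gt r by simp
qed

end
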